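(* Let $m\ge2$ and let $C$ be an $m\times m$ cost matrix with columns $C_1,\ldots,C_m$. Define a loss with action space $\Delta_m$ by $$L^{\mathrm{cw2}}(j,\lambda)=(C\lambda)_j,\qquad j\in\{1,\ldots,m\},\ \lambda\in\Delta_m,$$ where $(C\lambda)_j$ is the $j$th component of $C\lambda$. Then $L^{\mathrm{cw2}}$ induces the same generalized entropy as does the cost-weighted classification loss $L^{\mathrm{cw}}$, namely $H^{\mathrm{cw}}(\eta)=\min_{k}\eta^{T}C_k$; that is, for all $\eta\in\Delta_m$, $$\inf_{\lambda\in\Delta_m}\sum_{j=1}^m\eta_jL^{\mathrm{cw2}}(j,\lambda)=\min_{k\in\{1,\ldots,m\}}\eta^{T}C_k.$$
   Context: $\Delta_m=\{q\in\mathbb R^m: q_j\ge0,\ \sum_jq_j=1\}$. A cost matrix is $C=(c_{jk})$ with $c_{jk}\ge0$, $c_{jj}=0$, and for each $j$, $c_{jk}>0$ for some $k\ne j$. The generalized entropy of a loss $L(j,\gamma)$ with action space $\mathcal A$ is $H_L(\eta)=\inf_{\gamma\in\mathcal A}\sum_j\eta_jL(j,\gamma)$, $\eta\in\Delta_m$. The cost-weighted classification loss is $L^{\mathrm{cw}}(j,\gamma)=c_{jk}$ if $k=\mathrm{argmax}_l\gamma_l$, for $\gamma\in\mathbb R^m$ (ties broken by any fixed rule); its generalized entropy is $H^{\mathrm{cw}}(\eta)=\min_k\eta^{T}C_k$. *)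

theory Defs
  imports "HOL-Analysis.Analysis"
begin

text \<open>The index set \<open>{1, ..., m}\<close> is the finite type \<open>'m\<close>, so that \<open>m = CARD('m)\<close>.\<close>

definition prob_simplex :: "(real ^ 'm::finite) set" where
  "prob_simplex = {q. (\<forall>j. 0 \<le> q $ j) \<and> (\<Sum>j\<in>UNIV. q $ j) = 1}"

text \<open>\<open>C $ j $ k\<close> is the cost of predicting class \<open>k\<close> when the true class is \<open>j\<close>.\<close>

definition cost_matrix :: "real ^ 'm ^ 'm::finite \<Rightarrow> bool" where
  "cost_matrix C \<longleftrightarrow>
     (\<forall>j k. 0 \<le> C $ j $ k) \<and> (\<forall>j. C $ j $ j = 0) \<and> (\<forall>j. \<exists>k. k \<noteq> j \<and> 0 < C $ j $ k)"

text \<open>The infimum is taken in the extended reals, where it always exists.\<close>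

definition generalized_entropy ::
    "'a set \<Rightarrow> ('m \<Rightarrow> 'a \<Rightarrow> real) \<Rightarrow> real ^ 'm::finite \<Rightarrow> ereal" where
  "generalized_entropy A L \<eta> = (INF \<gamma>\<in>A. ereal (\<Sum>j\<in>UNIV. \<eta> $ j * L j \<gamma>))"

text \<open>A choice, for every \<open>\<gamma>\<close>, of one maximizing index: ties are broken in an arbitrary but fixed way.\<close>

definition argmax_rule :: "(real ^ 'm::finite \<Rightarrow> 'm) \<Rightarrow> bool" where
  "argmax_rule r \<longleftrightarrow> (\<forall>\<gamma>. is_arg_max (\<lambda>l. \<gamma> $ l) (\<lambda>l. True) (r \<gamma>))"

definition L_cw :: "real ^ 'm ^ 'm::finite \<Rightarrow> (real ^ 'm \<Rightarrow> 'm) \<Rightarrow> 'm \<Rightarrow> real ^ 'm \<Rightarrow> real" where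
  "L_cw C r j \<gamma> = C $ j $ r \<gamma>"

definition L_cw2 :: "real ^ 'm ^ 'm::finite \<Rightarrow> 'm \<Rightarrow> real ^ 'm \<Rightarrow> real" where
  "L_cw2 C j l = (C *v l) $ j"

end

theory Submission
  imports Defs
begin

text \<open>The objective \<open>\<eta> \<bullet> C \<lambda>\<close> is a convex combination, with weights \<open>\<lambda>\<close>, of the values
  \<open>\<eta> \<bullet> C\<^sub>k\<close>, so it is at least their minimum, which is attained at a vertex of the simplex.
  For the cost-weighted loss, the predictions already range over all classes, since the
  \<open>k\<close>-th unit vector has \<open>k\<close> as its only maximizing index.\<close>

lemma axis_in_prob_simplex: "axis k 1 \<in> prob_simplex"
  by (auto simp: prob_simplex_def axis_def)

text \<open>Regrouping by columns turns the components of \<open>l\<close> into weights, the form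
  that \<open>Min_le_convex_combination\<close> bounds.\<close>

lemma inner_matrix_vector_mult_columns:
  fixes C :: "real ^ 'n ^ 'm"
  shows "\<eta> \<bullet> (C *v l) = (\<Sum>k\<in>UNIV. l $ k * (\<eta> \<bullet> column k C))"
  by (simp add: matrix_mult_sum inner_sum_right scalar_mult_eq_scaleR)

lemma Min_le_convex_combination:
  fixes f :: "'m::finite \<Rightarrow> real"
  assumes "l \<in> prob_simplex"
  shows "(MIN k. f k) \<le> (\<Sum>k\<in>UNIV. l $ k * f k)"
proof -
  have nonneg: "0 \<le> l $ k" for k
    using assms by (simp add: prob_simplex_def)
  have total: "(\<Sum>k\<in>UNIV. l $ k) = 1"
    using assms by (simp add: prob_simplex_def)
  \<comment> \<open>As the weights sum to 1, the minimum is a weighted sum of copies of itself,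
    ready for a termwise comparison.\<close>
  have "(MIN k. f k) = (\<Sum>k\<in>UNIV. l $ k * (MIN k. f k))"
    by (simp add: total flip: sum_distrib_right)
  also have "\<dots> \<le> (\<Sum>k\<in>UNIV. l $ k * f k)"
    by (intro sum_mono mult_left_mono nonneg) simp
  finally show ?thesis .
qed

text \<open>A unit vector has no ties, so every tie-breaking rule agrees there; hence
  \<open>r\<close> takes every value.\<close>

lemma argmax_rule_axis:
  assumes "argmax_rule r"
  shows "r (axis k 1) = k"
proof (rule ccontr)
  assume "r (axis k 1) \<noteq> k"
  then have "axis k (1::real) $ r (axis k 1) < axis k 1 $ k"
    by (simp add: axis_def)
  with assms show False
    unfolding argmax_rule_def is_arg_max_def by blast
qed

text \<open>Shared by both losses: attaining every \<open>f k\<close> includes attaining the least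
  one, so the lower bound is sharp.\<close>

lemma INF_ereal_eq_Min:
  fixes f :: "'m::finite \<Rightarrow> real"
  assumes "\<And>x. x \<in> A \<Longrightarrow> (MIN k. f k) \<le> g x"
    and "\<And>k. \<exists>x\<in>A. g x = f k"
  shows "(INF x\<in>A. ereal (g x)) = ereal (MIN k. f k)"
proof (rule antisym)
  have "(MIN k. f k) \<in> range f"
    by (rule Min_in) auto
  then obtain x where "x \<in> A" "g x = (MIN k. f k)"
    using assms(2) by (metis imageE)
  then show "(INF x\<in>A. ereal (g x)) \<le> ereal (MIN k. f k)"
    by (metis INF_lower)
  show "ereal (MIN k. f k) \<le> (INF x\<in>A. ereal (g x))"
    \<comment> \<open>\<open>Min_le_iff\<close> is removed so that the bound keeps the form in which
      \<open>assms(1)\<close> states it.\<close>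
    by (intro INF_greatest) (simp add: assms(1) del: Min_le_iff)
qed

lemma generalized_entropy_L_cw:
  assumes "argmax_rule r"
  shows "generalized_entropy UNIV (L_cw C r) \<eta> = ereal (MIN k. \<eta> \<bullet> column k C)"
proof -
  have objective: "(\<Sum>j\<in>UNIV. \<eta> $ j * L_cw C r j \<gamma>) = \<eta> \<bullet> column (r \<gamma>) C" for \<gamma>
    by (simp add: L_cw_def inner_vec_def column_def)
  show ?thesis
    unfolding generalized_entropy_def objective
  proof (rule INF_ereal_eq_Min)
    show "(MIN k. \<eta> \<bullet> column k C) \<le> \<eta> \<bullet> column (r \<gamma>) C" for \<gamma>
      by (rule Min_le) auto
    show "\<exists>\<gamma>\<in>UNIV. \<eta> \<bullet> column (r \<gamma>) C = \<eta> \<bullet> column k C" for k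
      \<comment> \<open>The witness is \<open>axis k 1\<close>, which \<open>r\<close> sends to
        \<open>k\<close>.\<close>
      using argmax_rule_axis[OF assms, of k] by (metis UNIV_I)
  qed
qed

lemma generalized_entropy_L_cw2:
  "generalized_entropy prob_simplex (L_cw2 C) \<eta> = ereal (MIN k. \<eta> \<bullet> column k C)"
proof -
  have objective: "(\<Sum>j\<in>UNIV. \<eta> $ j * L_cw2 C j l) = \<eta> \<bullet> (C *v l)" for l
    by (simp add: L_cw2_def inner_vec_def)
  show ?thesis
    unfolding generalized_entropy_def objective
  proof (rule INF_ereal_eq_Min)
    show "(MIN k. \<eta> \<bullet> column k C) \<le> \<eta> \<bullet> (C *v l)" if "l \<in> prob_simplex" for l
      unfolding inner_matrix_vector_mult_columns by (rule Min_le_convex_combination[OF that])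
    show "\<exists>l\<in>prob_simplex. \<eta> \<bullet> (C *v l) = \<eta> \<bullet> column k C" for k
      \<comment> \<open>At the vertex \<open>axis k 1\<close> the product \<open>C *v l\<close> is
        \<open>column k C\<close>.\<close>
      by (rule bexI[OF _ axis_in_prob_simplex[of k]]) (simp add: matrix_vector_mult_basis)
  qed
qed

theorem lemma3:
  fixes C :: "real ^ 'm ^ 'm::finite"
    and r :: "real ^ 'm \<Rightarrow> 'm"
  assumes "CARD('m) \<ge> 2"
    and "cost_matrix C"
    and "argmax_rule r"
  shows "\<forall>\<eta>\<in>prob_simplex.
           generalized_entropy prob_simplex (L_cw2 C) \<eta> = generalized_entropy UNIV (L_cw C r) \<eta> \<and>
           generalized_entropy prob_simplex (L_cw2 C) \<eta> = ereal (MIN k. \<eta> \<bullet> column k C)"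
  using generalized_entropy_L_cw[OF assms(3)] generalized_entropy_L_cw2 by metis

end
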